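(* Let $\le_\theta$ and $\le_{\theta'}$ be two stabilities on $S$ with Harder–Narasimhan collections $s_\theta$ and $s_{\theta'}$. For any $\alpha\in S^n$ and $1\le k<n$, let $\alpha_{\le k}=\alpha_1+\dots+\alpha_k$, $\alpha_{>k}=\alpha_{k+1}+\dots+\alpha_n$ and define $$\varepsilon_k(\alpha)=\begin{cases}-1&\alpha_k\le_\theta\alpha_{k+1}\text{ and }\alpha_{\le k}>_{\theta'}\alpha_{>k},\\1&\alpha_k>_\theta\alpha_{k+1}\text{ and }\alpha_{\le k}\le_{\theta'}\alpha_{>k},\\0&\text{otherwise.}\end{cases}$$ Then the collection $s_{\theta\to\theta'}=s_{\theta'}^{-1}\circ s_\theta$ satisfies $s_{\theta\to\theta'}(\alpha)=\prod_{k=1}^{n-1}\varepsilon_k(\alpha)$ for all $\alpha\in S^n$, $n\ge1$.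
   Context: $S$ is a commutative semigroup (written additively) such that every element of $S$ can be represented as a sum $\alpha_1+\dots+\alpha_n$ ($n\ge1$, $\alpha_i\in S$) in only finitely many ways (e.g. $S=\mathbb N^r\setminus\{0\}$). Put $S^*=\bigsqcup_{n\ge1}S^n$. A collection is a map $F:S^*\to\mathbb Q$. The plethysm of collections $F,G$ is $$(F\circ G)(\alpha)=\sum_{\pi}F(\pi_*\alpha)\prod_{j=1}^mG(\alpha|_{\pi^{-1}(j)}),\qquad\alpha\in S^n,$$ where the sum runs over all $m\ge1$ and all order-preserving surjections $\pi:\{1,\dots,n\}\to\{1,\dots,m\}$, $(\pi_*\alpha)_j=\sum_{i\in\pi^{-1}(j)}\alpha_i$, and $\alpha|_{\pi^{-1}(j)}$ is the restricted tuple. The identity collection $\mathbf 1$ takes value $1$ on $S^1$ and $0$ on $S^n$, $n>1$; plethysm is associative with unit $\mathbf 1$. Every collection with value $1$ on all elements of $S=S^1$ has a two-sided inverse with respect to $\circ$, denoted by the exponent $-1$. A (weak) stability $\le$ on $S$ is a preorder (a transitive relation with any two elements comparable) such that for any $a,b\in S$ either $a\le a+b\le b$ or $b\le a+b\le a$. Write $a<b$ if $a\le b$ and $b\not\le a$. The Harder–Narasimhan collection of $\le$ is $s:S^*\to\mathbb Q$ with $s(\alpha)=1$ if $\alpha_1>\dots>\alpha_n$ and $s(\alpha)=0$ otherwise, for $\alpha\in S^n$. The empty product is $1$. *)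

theory Defs
  imports Complex_Main "HOL-Library.FuncSet"
begin

text \<open>
  The semigroup \<open>S\<close> is a type of class \<^class>\<open>ab_semigroup_add\<close>; there is no zero, so only
  nonempty lists have a sum (and \<open>nsum []\<close> is left unspecified).
  An element of \<open>S\<^sup>n\<close> is a list of length \<open>n\<close>, whose entries are indexed from \<open>0\<close>.
\<close>

fun nsum :: "'a::ab_semigroup_add list \<Rightarrow> 'a" where
  "nsum [x] = x"
| "nsum (x # y # ys) = x + nsum (y # ys)"

text \<open>
  The domain of a collection is the set of nonempty lists. We represent it by its extension by
  \<open>0\<close> to the empty list, so that equality of collections is equality of functions.
\<close>

definition collection :: "('a list \<Rightarrow> rat) \<Rightarrow> bool" where
  "collection F \<longleftrightarrow> F [] = 0"

definition order_surj :: "nat \<Rightarrow> nat \<Rightarrow> (nat \<Rightarrow> nat) set" where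
  "order_surj n m =
    {\<pi> \<in> {..<n} \<rightarrow>\<^sub>E {..<m}. mono_on {..<n} \<pi> \<and> \<pi> ` {..<n} = {..<m}}"

definition restrict_fibre :: "(nat \<Rightarrow> nat) \<Rightarrow> nat \<Rightarrow> 'a list \<Rightarrow> 'a list" where
  "restrict_fibre \<pi> j \<alpha> = nths \<alpha> {i. i < length \<alpha> \<and> \<pi> i = j}"

definition pushforward :: "(nat \<Rightarrow> nat) \<Rightarrow> nat \<Rightarrow> 'a::ab_semigroup_add list \<Rightarrow> 'a list" where
  "pushforward \<pi> m \<alpha> = map (\<lambda>j. nsum (restrict_fibre \<pi> j \<alpha>)) [0..<m]"

text \<open>
  Surjectivity forces \<open>m \<le> n\<close>, so bounding \<open>m\<close> loses no summand. On the empty list the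
  sum is empty and the value is \<open>0\<close>.
\<close>

definition plethysm ::
    "('a::ab_semigroup_add list \<Rightarrow> rat) \<Rightarrow> ('a list \<Rightarrow> rat) \<Rightarrow> 'a list \<Rightarrow> rat" where
  "plethysm F G \<alpha> =
    (\<Sum>m = 1..length \<alpha>. \<Sum>\<pi> \<in> order_surj (length \<alpha>) m.
       F (pushforward \<pi> m \<alpha>) * (\<Prod>j<m. G (restrict_fibre \<pi> j \<alpha>)))"

definition id_collection :: "'a list \<Rightarrow> rat" where
  "id_collection \<alpha> = (if length \<alpha> = 1 then 1 else 0)"

definition plethysm_inverse ::
    "('a::ab_semigroup_add list \<Rightarrow> rat) \<Rightarrow> 'a list \<Rightarrow> rat" where
  "plethysm_inverse F =
    (THE G. collection G \<and> plethysm F G = id_collection \<and> plethysm G F = id_collection)"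

definition stability :: "('a::ab_semigroup_add \<Rightarrow> 'a \<Rightarrow> bool) \<Rightarrow> bool" where
  "stability le \<longleftrightarrow>
    transp le \<and> (\<forall>a b. le a b \<or> le b a) \<and>
    (\<forall>a b. (le a (a + b) \<and> le (a + b) b) \<or> (le b (a + b) \<and> le (a + b) a))"

definition strict :: "('a \<Rightarrow> 'a \<Rightarrow> bool) \<Rightarrow> 'a \<Rightarrow> 'a \<Rightarrow> bool" where
  "strict le a b \<longleftrightarrow> le a b \<and> \<not> le b a"

definition HN_collection :: "('a \<Rightarrow> 'a \<Rightarrow> bool) \<Rightarrow> 'a list \<Rightarrow> rat" where
  "HN_collection le \<alpha> =
    (if \<alpha> \<noteq> [] \<and> successively (\<lambda>x y. strict le y x) \<alpha> then 1 else 0)"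

text \<open>
  Here \<open>1 \<le> k < length \<alpha>\<close>. As lists are indexed from \<open>0\<close>, the entries
  \<open>\<alpha>\<^sub>k\<close> and \<open>\<alpha>\<^sub>k\<^sub>+\<^sub>1\<close> are \<open>\<alpha> ! (k - 1)\<close> and \<open>\<alpha> ! k\<close>.
\<close>

definition wc_sign ::
    "('a::ab_semigroup_add \<Rightarrow> 'a \<Rightarrow> bool) \<Rightarrow> ('a \<Rightarrow> 'a \<Rightarrow> bool) \<Rightarrow> 'a list \<Rightarrow> nat \<Rightarrow> rat" where
  "wc_sign le le' \<alpha> k =
    (if le (\<alpha> ! (k - 1)) (\<alpha> ! k) \<and> strict le' (nsum (drop k \<alpha>)) (nsum (take k \<alpha>)) then -1
     else if strict le (\<alpha> ! k) (\<alpha> ! (k - 1)) \<and> le' (nsum (take k \<alpha>)) (nsum (drop k \<alpha>)) then 1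
     else 0)"

definition transition_collection ::
    "('a::ab_semigroup_add \<Rightarrow> 'a \<Rightarrow> bool) \<Rightarrow> ('a \<Rightarrow> 'a \<Rightarrow> bool) \<Rightarrow> 'a list \<Rightarrow> rat" where
  "transition_collection le le' =
    plethysm (plethysm_inverse (HN_collection le')) (HN_collection le)"

end

theory Submission
  imports Defs
begin

text \<open>
  Write \<open>A k = [\<alpha>\<^sub>k > \<alpha>\<^sub>k\<^sub>+\<^sub>1]\<close> for the first stability and \<open>B k = [\<alpha>\<^sub>\<le>\<^sub>k > \<alpha>\<^sub>>\<^sub>k]\<close> for the second,
  both taken to be \<open>0\<close> or \<open>1\<close>. Since the preorders are total, the sign at position \<open>k\<close> is
  \<open>A k - B k\<close>, and the theorem follows from two facts.

  The first is that the inverse of the Harder--Narasimhan collection of the second stability is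
  explicit: it is the collection \<open>g\<close> with \<open>g \<alpha> = (\<Prod>k. - B k)\<close> (\<open>plethysm_inverse_HN\<close>).

  The second is pure algebra and holds for arbitrary weights \<open>A\<close> and \<open>B\<close>
  (\<open>plethysm_cut_adjacent\<close>). Expanding \<open>\<Prod>k. (A k - B k)\<close> means choosing at each position
  either \<open>A k\<close> or \<open>- B k\<close>. Cut \<open>\<alpha>\<close> at the positions of the second kind. The factors \<open>A k\<close>
  sit inside the blocks, where they multiply to the Harder--Narasimhan collection of the first
  stability. The factors \<open>- B k\<close> compare the total of the blocks before a cut with the total of
  those after it, so they depend only on the block sums and multiply to \<open>g\<close> of the list of block
  sums. The expansion is therefore exactly the plethysm of \<open>g\<close> with that collection.

  The second fact also gives the first. Taking both stabilities equal, it says that \<open>g\<close> composed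
  with its Harder--Narasimhan collection has the value \<open>\<Prod>k. (A k - B k)\<close>, and for \<open>n \<ge> 2\<close> one
  factor vanishes: if \<open>A k \<noteq> B k\<close> for every \<open>k\<close>, the comparison of \<open>\<alpha>\<^sub>1\<close> with the sum of the
  other entries propagates along the list by the seesaw property, until it contradicts
  \<open>A (n - 1) \<noteq> B (n - 1)\<close> (\<open>diff_prod_descending_zero\<close> and \<open>diff_prod_ascending_zero\<close>). So \<open>g\<close>
  is a left inverse. Associativity, together with cancellation on the right, makes it the unique
  two-sided inverse (\<open>plethysm_inverse_eqI\<close>).
\<close>

section \<open>Plethysm as a sum over block decompositions\<close>

text \<open>
  An order-preserving surjection from \<open>{1..n}\<close> to \<open>{1..m}\<close> is the same thing as a cutting of
  an \<open>n\<close>-tuple into \<open>m\<close> nonempty consecutive blocks. Lists of blocks admit induction along the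
  tuple, so all later computations take place in this form.
\<close>

definition splits :: "'a list \<Rightarrow> 'a list list set" where
  "splits \<alpha> = {bs. concat bs = \<alpha> \<and> [] \<notin> set bs}"

lemma splits_Nil: "splits [] = {[]}"
proof -
  have "bs = []" if "concat bs = []" "[] \<notin> set bs" for bs :: "'a list list"
    using that by (cases bs) auto
  then show ?thesis by (auto simp: splits_def)
qed

lemma splits_single: "splits [x] = {[[x]]}"
proof -
  have "bs = [[x]]" if "concat bs = [x]" "[] \<notin> set bs" for bs :: "'a list list"
  proof (cases bs)
    case (Cons b bs')
    with that obtain b' where "b = x # b'" by (cases b) auto
    with that Cons have "b' = []" "concat bs' = []" by auto
    with that Cons \<open>b = x # b'\<close> show ?thesis by (cases bs') auto
  qed (use that in auto)
  then show ?thesis by (auto simp: splits_def)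
qed

text \<open>
  A cut between the first two entries is either present or absent; deleting the first entry leaves
  the other cuts unchanged.
\<close>

lemma splits_Cons_Cons:
  "splits (x # y # ys) =
     (#) [x] ` splits (y # ys) \<union> (\<lambda>bs. (x # hd bs) # tl bs) ` splits (y # ys)"
    (is "?L = ?R")
proof (rule set_eqI)
  fix bs
  show "bs \<in> ?L \<longleftrightarrow> bs \<in> ?R"
  proof
    assume "bs \<in> ?L"
    then have bs: "concat bs = x # y # ys" "[] \<notin> set bs" by (auto simp: splits_def)
    then obtain b cs where b: "bs = b # cs" by (cases bs) auto
    with bs obtain b' where b': "b = x # b'" by (cases b) auto
    show "bs \<in> ?R"
    proof (cases "b' = []")
      case True
      with bs b b' show ?thesis by (auto simp: splits_def)
    next
      case False
      with bs b b' have "b' # cs \<in> splits (y # ys)" by (auto simp: splits_def)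
      then have "(x # hd (b' # cs)) # tl (b' # cs) \<in> ?R" by blast
      with b b' show ?thesis by simp
    qed
  next
    assume "bs \<in> ?R"
    then obtain cs where cs: "cs \<in> splits (y # ys)"
      "bs = [x] # cs \<or> bs = (x # hd cs) # tl cs" by blast
    then show "bs \<in> ?L" by (cases cs) (auto simp: splits_def)
  qed
qed

lemma finite_splits: "finite (splits \<alpha>)"
proof (induction \<alpha>)
  case (Cons x xs)
  then show ?case by (cases xs) (auto simp: splits_single splits_Cons_Cons)
qed (simp add: splits_Nil)

lemma splits_nonempty: "bs \<in> splits (x # xs) \<Longrightarrow> bs \<noteq> []"
  by (auto simp: splits_def)

lemma sum_splits_Cons_Cons:
  fixes h :: "'a list list \<Rightarrow> 'b::comm_monoid_add"
  shows "sum h (splits (x # y # ys)) =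
    (\<Sum>bs\<in>splits (y # ys). h ([x] # bs) + h ((x # hd bs) # tl bs))"
proof -
  let ?S = "splits (y # ys)"
  have inj2: "inj_on (\<lambda>bs. (x # hd bs) # tl bs) ?S"
    by (rule inj_onI) (metis list.inject list.collapse splits_nonempty)
  have disj: "(#) [x] ` ?S \<inter> (\<lambda>bs. (x # hd bs) # tl bs) ` ?S = {}"
  proof -
    have "hd bs \<noteq> []" if "bs \<in> ?S" for bs
      using that splits_nonempty[OF that] by (cases bs) (auto simp: splits_def)
    then have "[x] # cs \<noteq> (x # hd bs) # tl bs" if "bs \<in> ?S" for bs cs
      using that by (metis list.inject)
    then show ?thesis by blast
  qed
  show ?thesis
    unfolding splits_Cons_Cons
    by (subst sum.union_disjoint)
      (auto simp: finite_splits disj sum.reindex inj2 sum.distrib)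
qed

lemma finite_order_surj: "finite (order_surj n m)"
  unfolding order_surj_def
  by (rule finite_subset[of _ "{..<n} \<rightarrow>\<^sub>E {..<m}"]) (auto intro: finite_PiE)

definition blocks :: "(nat \<Rightarrow> nat) \<Rightarrow> nat \<Rightarrow> 'a list \<Rightarrow> 'a list list" where
  "blocks \<pi> m \<alpha> = map (\<lambda>j. restrict_fibre \<pi> j \<alpha>) [0..<m]"

lemma length_restrict_fibre:
  "length (restrict_fibre \<pi> j \<alpha>) = card {i. i < length \<alpha> \<and> \<pi> i = j}"
  unfolding restrict_fibre_def length_nths by (intro arg_cong[of _ _ card]) auto

lemma downward_closed_eq_lessThan:
  fixes A :: "nat set"
  assumes "finite A" "\<And>i j. j \<in> A \<Longrightarrow> i < j \<Longrightarrow> i \<in> A"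
  shows "A = {..<card A}"
proof (cases "A = {}")
  case False
  have "A = {..Max A}"
  proof (intro equalityI subsetI)
    fix i assume "i \<in> {..Max A}"
    moreover have "Max A \<in> A" using assms(1) False by simp
    ultimately show "i \<in> A" using assms(2)[of "Max A" i] by (cases "i = Max A") auto
  qed (use assms(1) in simp)
  then show ?thesis
    by (metis card_atMost lessThan_Suc_atMost)
qed simp

text \<open>
  The fibres of an order-preserving map are intervals. Their endpoints are the partial sums of the
  fibre sizes, because a sublevel set of the map is an initial segment with that many elements.
  This shows both that the fibres concatenate to the whole list and that they determine the map.
\<close>

lemma mono_sublevel:
  assumes "mono_on {..<length \<alpha>} \<pi>"
  shows "{i. i < length \<alpha> \<and> \<pi> i < j} = {..<\<Sum>l<j. length (restrict_fibre \<pi> l \<alpha>)}"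
proof -
  let ?A = "\<lambda>j. {i. i < length \<alpha> \<and> \<pi> i < j}"
  have card: "card (?A j) = (\<Sum>l<j. length (restrict_fibre \<pi> l \<alpha>))" for j
  proof (induction j)
    case (Suc j)
    have "?A (Suc j) = ?A j \<union> {i. i < length \<alpha> \<and> \<pi> i = j}" by auto
    also have "card \<dots> = card (?A j) + card {i. i < length \<alpha> \<and> \<pi> i = j}"
      by (rule card_Un_disjoint) auto
    finally show ?case using Suc by (simp add: length_restrict_fibre)
  qed simp
  have "?A j = {..<card (?A j)}"
  proof (rule downward_closed_eq_lessThan)
    fix i k assume "k \<in> ?A j" "i < k"
    then show "i \<in> ?A j"
      using monotone_onD[OF assms, of i k] by auto
  qed auto
  then show ?thesis by (simp add: card)
qed

lemma concat_blocks:
  assumes "mono_on {..<length \<alpha>} \<pi>"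
  shows "concat (blocks \<pi> m \<alpha>) = take (\<Sum>l<m. length (restrict_fibre \<pi> l \<alpha>)) \<alpha>"
proof (induction m)
  case (Suc m)
  let ?c = "\<lambda>j. \<Sum>l<j. length (restrict_fibre \<pi> l \<alpha>)"
  let ?d = "length (restrict_fibre \<pi> m \<alpha>)"
  have "{i. i < length \<alpha> \<and> \<pi> i = m} =
      {i. i < length \<alpha> \<and> \<pi> i < Suc m} - {i. i < length \<alpha> \<and> \<pi> i < m}" by auto
  also have "\<dots> = {?c m..<?c m + ?d}"
    unfolding mono_sublevel[OF assms] by auto
  also have "\<dots> = (+) (?c m) ` {..<?d}"
    by (auto simp: lessThan_atLeast0 add.commute)
  finally have "restrict_fibre \<pi> m \<alpha> = nths (drop (?c m) \<alpha>) {..<?d}"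
    unfolding nths_drop by (simp only: restrict_fibre_def[of \<pi> m \<alpha>])
  then have "restrict_fibre \<pi> m \<alpha> = take ?d (drop (?c m) \<alpha>)"
    by (simp only: nths_upt_eq_take)
  then show ?case
    using Suc by (simp add: blocks_def take_add)
qed (simp add: blocks_def)

lemma blocks_in_splits:
  assumes "\<pi> \<in> order_surj (length \<alpha>) m"
  shows "blocks \<pi> m \<alpha> \<in> splits \<alpha>"
proof -
  have mono: "mono_on {..<length \<alpha>} \<pi>" and surj: "\<pi> ` {..<length \<alpha>} = {..<m}"
    using assms by (auto simp: order_surj_def)
  have "{i. i < length \<alpha> \<and> \<pi> i < m} = {..<length \<alpha>}" using surj by auto
  then have "(\<Sum>l<m. length (restrict_fibre \<pi> l \<alpha>)) = length \<alpha>"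
    unfolding mono_sublevel[OF mono] by simp
  moreover have "restrict_fibre \<pi> j \<alpha> \<noteq> []" if "j < m" for j
  proof -
    have "j \<in> \<pi> ` {..<length \<alpha>}" using that surj by simp
    then have "{i. i < length \<alpha> \<and> \<pi> i = j} \<noteq> {}" by auto
    then have "length (restrict_fibre \<pi> j \<alpha>) \<noteq> 0"
      by (simp add: length_restrict_fibre card_eq_0_iff)
    then show ?thesis by auto
  qed
  ultimately show ?thesis
    unfolding splits_def mem_Collect_eq concat_blocks[OF mono]
    by (metis (no_types, lifting) atLeastLessThan_iff atLeastLessThan_upt blocks_def
        imageE order.refl set_map take_all)
qed

lemma blocks_inject:
  assumes "\<pi> \<in> order_surj (length \<alpha>) m" "\<rho> \<in> order_surj (length \<alpha>) m"
    and eq: "blocks \<pi> m \<alpha> = blocks \<rho> m \<alpha>"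
  shows "\<pi> = \<rho>"
proof (rule ext)
  fix i
  have mono: "mono_on {..<length \<alpha>} \<pi>" "mono_on {..<length \<alpha>} \<rho>"
    and ext: "\<pi> \<in> extensional {..<length \<alpha>}" "\<rho> \<in> extensional {..<length \<alpha>}"
    and bound: "i < length \<alpha> \<Longrightarrow> \<pi> i < m" "i < length \<alpha> \<Longrightarrow> \<rho> i < m"
    using assms by (auto simp: order_surj_def PiE_def)
  have fib: "restrict_fibre \<pi> l \<alpha> = restrict_fibre \<rho> l \<alpha>" if "l < m" for l
    using eq that by (auto simp: blocks_def)
  have level: "\<pi> i < j \<longleftrightarrow> \<rho> i < j" if "i < length \<alpha>" "j \<le> m" for j
  proof -
    have "(\<Sum>l<j. length (restrict_fibre \<pi> l \<alpha>)) = (\<Sum>l<j. length (restrict_fibre \<rho> l \<alpha>))"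
      using that fib by (intro sum.cong) auto
    then have "{i. i < length \<alpha> \<and> \<pi> i < j} = {i. i < length \<alpha> \<and> \<rho> i < j}"
      by (simp only: mono_sublevel[OF mono(1)] mono_sublevel[OF mono(2)])
    with that show ?thesis by blast
  qed
  show "\<pi> i = \<rho> i"
  proof (cases "i < length \<alpha>")
    case True
    then show ?thesis
      using level[OF True, of "\<pi> i"] level[OF True, of "\<rho> i"] bound by auto
  next
    case False
    then show ?thesis using ext by (simp add: extensional_def)
  qed
qed

text \<open>
  One more block at the end adds one more value, taken on the new final positions.
\<close>

lemma blocks_surj:
  assumes "[] \<notin> set bs"
  shows "\<exists>\<pi> \<in> order_surj (length (concat bs)) (length bs). blocks \<pi> (length bs) (concat bs) = bs"
  using assms
proof (induction bs rule: rev_induct)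
  case Nil
  then show ?case
    by (simp add: order_surj_def blocks_def monotone_on_def)
next
  case (snoc b bs)
  let ?m = "length bs" and ?N = "length (concat bs)" and ?xs = "concat bs"
  obtain \<pi> where \<pi>: "\<pi> \<in> order_surj ?N ?m" "blocks \<pi> ?m ?xs = bs"
    using snoc by auto
  let ?M = "?N + length b"
  have "b \<noteq> []" using snoc by auto
  define \<rho> where "\<rho> i = (if i < ?N then \<pi> i else if i < ?M then ?m else undefined)" for i
  have mono: "\<pi> i \<le> \<pi> j" if "i \<le> j" "j < ?N" for i j
    using \<pi>(1) that by (auto simp: order_surj_def mono_on_def)
  have lt: "\<pi> i < ?m" if "i < ?N" for i
    using \<pi>(1) that by (auto simp: order_surj_def)
  have img: "\<pi> ` {..<?N} = {..<?m}"
    using \<pi>(1) by (auto simp: order_surj_def)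
  have "\<rho> ` {..<?M} = \<rho> ` {..<?N} \<union> \<rho> ` {?N..<?M}"
    by (simp add: image_Un[symmetric] ivl_disj_un)
  also have "\<rho> ` {..<?N} = {..<?m}"
    unfolding img[symmetric] by (auto simp: \<rho>_def)
  also have "\<rho> ` {?N..<?M} = {?m}"
    using \<open>b \<noteq> []\<close> by (auto simp: \<rho>_def image_iff Bex_def intro!: exI[of _ ?N])
  finally have img': "\<rho> ` {..<?M} = {..<Suc ?m}" by auto
  have "mono_on {..<?M} \<rho>"
    by (rule mono_onI) (auto simp: \<rho>_def mono less_imp_le[OF lt])
  moreover have "\<rho> \<in> {..<?M} \<rightarrow>\<^sub>E {..<Suc ?m}"
    by (auto simp: \<rho>_def PiE_def extensional_def less_SucI lt)
  ultimately have mem: "\<rho> \<in> order_surj ?M (Suc ?m)"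
    using img' by (auto simp: order_surj_def)
  have "restrict_fibre \<rho> j (?xs @ b) = restrict_fibre \<pi> j ?xs" if "j < ?m" for j
  proof -
    have "nths b {i. i + ?N < ?M \<and> \<rho> (i + ?N) = j} = nths b {}"
      using that by (intro arg_cong[of _ _ "nths b"]) (auto simp: \<rho>_def)
    moreover have "nths ?xs {i. i < ?M \<and> \<rho> i = j} = nths ?xs {i. i < ?N \<and> \<pi> i = j}"
      using that by (intro arg_cong[of _ _ "nths ?xs"]) (auto simp: \<rho>_def split: if_splits)
    ultimately show ?thesis by (simp add: restrict_fibre_def nths_append)
  qed
  moreover have "restrict_fibre \<rho> ?m (?xs @ b) = b"
  proof -
    have "nths b {i. i + ?N < ?M \<and> \<rho> (i + ?N) = ?m} = nths b {..<length b}"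
      by (intro arg_cong[of _ _ "nths b"]) (auto simp: \<rho>_def)
    moreover have "nths ?xs {i. i < ?M \<and> \<rho> i = ?m} = nths ?xs {i. False}"
      unfolding nths_def
      by (intro arg_cong[of _ _ "map fst"] filter_cong)
        (auto simp: \<rho>_def set_zip dest: lt)
    ultimately show ?thesis by (simp add: restrict_fibre_def nths_append)
  qed
  ultimately have "blocks \<rho> (Suc ?m) (?xs @ b) = map (\<lambda>j. restrict_fibre \<pi> j ?xs) [0..<?m] @ [b]"
    by (simp add: blocks_def)
  also have "\<dots> = bs @ [b]" using \<pi>(2) by (simp add: blocks_def)
  finally show ?case using mem by auto
qed

lemma plethysm_splits:
  assumes "collection F"
  shows "plethysm F G \<alpha> = (\<Sum>bs\<in>splits \<alpha>. F (map nsum bs) * prod_list (map G bs))"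
proof (cases "\<alpha> = []")
  case True
  then show ?thesis using assms by (simp add: plethysm_def splits_Nil collection_def)
next
  case False
  let ?n = "length \<alpha>"
  let ?t = "\<lambda>bs. F (map nsum bs) * prod_list (map G bs)"
  have summand: "F (pushforward \<pi> m \<alpha>) * (\<Prod>j<m. G (restrict_fibre \<pi> j \<alpha>)) = ?t (blocks \<pi> m \<alpha>)"
    for \<pi> m
    by (simp add: pushforward_def blocks_def o_def prod.distinct_set_conv_list[symmetric]
        lessThan_atLeast0)
  have "bij_betw (\<lambda>(m, \<pi>). blocks \<pi> m \<alpha>) (Sigma {1..?n} (order_surj ?n)) (splits \<alpha>)"
  proof (rule bij_betw_imageI)
    show "inj_on (\<lambda>(m, \<pi>). blocks \<pi> m \<alpha>) (Sigma {1..?n} (order_surj ?n))"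
    proof (rule inj_onI, clarify)
      fix m \<pi> k \<rho>
      assume \<pi>: "\<pi> \<in> order_surj ?n m" and \<rho>: "\<rho> \<in> order_surj ?n k"
        and eq: "blocks \<pi> m \<alpha> = blocks \<rho> k \<alpha>"
      have "m = k" using arg_cong[OF eq, of length] by (simp add: blocks_def)
      with \<pi> \<rho> eq show "m = k \<and> \<pi> = \<rho>" using blocks_inject by blast
    qed
    show "(\<lambda>(m, \<pi>). blocks \<pi> m \<alpha>) ` Sigma {1..?n} (order_surj ?n) = splits \<alpha>"
    proof (intro equalityI subsetI)
      fix bs assume bs: "bs \<in> splits \<alpha>"
      then obtain \<pi> where \<pi>: "\<pi> \<in> order_surj ?n (length bs)" "blocks \<pi> (length bs) \<alpha> = bs"
        using blocks_surj[of bs] by (auto simp: splits_def)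
      have "card (\<pi> ` {..<?n}) \<le> ?n" using card_image_le[of "{..<?n}" \<pi>] by simp
      then have "length bs \<le> ?n" using \<pi>(1) by (simp add: order_surj_def)
      moreover have "length bs \<noteq> 0" using bs False by (auto simp: splits_def)
      ultimately show "bs \<in> (\<lambda>(m, \<pi>). blocks \<pi> m \<alpha>) ` Sigma {1..?n} (order_surj ?n)"
        using \<pi> by (intro image_eqI[of _ _ "(length bs, \<pi>)"]) (auto simp: Suc_le_eq)
    qed (auto intro: blocks_in_splits)
  qed
  from sum.reindex_bij_betw[OF this, of ?t]
  show ?thesis
    unfolding plethysm_def summand by (simp add: sum.Sigma finite_order_surj case_prod_unfold)
qed

section \<open>The monoid of collections\<close>

lemma collection_plethysm: "collection (plethysm F G)"
  by (simp add: collection_def plethysm_def)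

lemma concat_map_concat: "concat (map concat css) = concat (concat css)"
  by (induction css) auto

lemma nsum_Cons: "xs \<noteq> [] \<Longrightarrow> nsum (x # xs) = x + nsum xs"
  by (cases xs) auto

lemma nsum_append: "xs \<noteq> [] \<Longrightarrow> ys \<noteq> [] \<Longrightarrow> nsum (xs @ ys) = nsum xs + nsum ys"
  by (induction xs rule: nsum.induct) (auto simp: nsum_Cons add.assoc)

lemma nsum_map_nsum: "bs \<noteq> [] \<Longrightarrow> [] \<notin> set bs \<Longrightarrow> nsum (map nsum bs) = nsum (concat bs)"
proof (induction bs)
  case (Cons b bs)
  have "concat bs \<noteq> []" if "bs \<noteq> []" using that Cons.prems by (cases bs) auto
  with Cons show ?case
    by (cases "bs = []") (auto simp: nsum_Cons nsum_append simp del: concat_eq_Nil_conv)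
qed simp

text \<open>
  Cuttings depend only on the positions, so they commute with relabelling the entries.
\<close>

lemma sum_splits_map:
  "sum h (splits (map f xs)) = (\<Sum>bs\<in>splits xs. h (map (map f) bs))"
proof (induction xs arbitrary: h)
  case (Cons x xs)
  show ?case
  proof (cases xs)
    case (Cons y ys)
    have "sum h (splits (map f (x # xs))) =
        (\<Sum>bs\<in>splits xs. h ([f x] # map (map f) bs) + h ((f x # hd (map (map f) bs)) # tl (map (map f) bs)))"
      using Cons.IH by (simp add: Cons sum_splits_Cons_Cons)
    also have "\<dots> = (\<Sum>bs\<in>splits (x # xs). h (map (map f) bs))"
      unfolding Cons sum_splits_Cons_Cons
      by (intro sum.cong refl) (auto simp: hd_map map_tl dest: splits_nonempty)
    finally show ?thesis .
  qed (simp add: splits_single)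
qed (simp add: splits_Nil)

text \<open>
  A refinement cuts every block of \<open>ds\<close> further; it keeps a separate list of pieces for each block.
\<close>

definition refinements :: "'a list list \<Rightarrow> 'a list list list set" where
  "refinements ds = {ess. map concat ess = ds \<and> [] \<notin> set (concat ess)}"

lemma refinements_Cons:
  "refinements (d # ds) = (\<lambda>(es, ess). es # ess) ` (splits d \<times> refinements ds)"
  by (auto simp: refinements_def splits_def image_iff Cons_eq_map_conv map_eq_Cons_conv)

text \<open>
  Distributivity: a cutting is chosen independently for each block.
\<close>

lemma prod_list_sum_splits:
  fixes h :: "'a list list \<Rightarrow> 'b::comm_semiring_1"
  shows "prod_list (map (\<lambda>d. sum h (splits d)) ds) = (\<Sum>ess\<in>refinements ds. prod_list (map h ess))"
proof (induction ds)
  case (Cons d ds)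
  have "(\<Sum>ess\<in>refinements (d # ds). prod_list (map h ess)) =
      (\<Sum>(es, ess)\<in>splits d \<times> refinements ds. h es * prod_list (map h ess))"
    unfolding refinements_Cons
    by (subst sum.reindex) (auto simp: inj_on_def case_prod_unfold)
  also have "\<dots> = sum h (splits d) * (\<Sum>ess\<in>refinements ds. prod_list (map h ess))"
    by (simp add: sum_product sum.cartesian_product)
  finally show ?case using Cons by simp
next
  case Nil
  have "refinements [] = {[] :: 'a list list list}" by (auto simp: refinements_def)
  then show ?case by simp
qed

lemma prod_list_map_concat: "prod_list (map H (concat bss)) = prod_list (map (\<lambda>bs. prod_list (map H bs)) bss)"
  for H :: "'a \<Rightarrow> 'b::comm_monoid_mult"
  by (induction bss) auto

lemma prod_list_map_mult:
  "prod_list (map (\<lambda>x. f x * g x) xs) = prod_list (map f xs) * prod_list (map g xs)"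
  for f g :: "'a \<Rightarrow> 'b::comm_monoid_mult"
  by (induction xs) (auto simp: mult_ac)

text \<open>
  Both sides are sums over two-level cuttings of \<open>\<alpha>\<close>. The left side chooses the fine blocks first
  and then groups them, and the right side chooses the coarse blocks first and then refines them.
  The summands agree because the sum of a coarse block is the sum of the sums of its fine blocks.
\<close>

lemma plethysm_assoc:
  assumes F: "collection F" and G: "collection G"
  shows "plethysm (plethysm F G) H = plethysm F (plethysm G H)"
proof (rule ext)
  fix \<alpha> :: "'a list"
  \<comment> \<open>\<open>T\<close> consists of the two-level cuttings; an element lists the coarse blocks, each as the list
    of its fine blocks.\<close>
  define T where "T = {css. concat (concat css) = \<alpha> \<and> [] \<notin> set css \<and> [] \<notin> set (concat css)}"
  define h where "h css = F (map nsum (map concat css)) *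
    prod_list (map (\<lambda>c. G (map nsum c) * prod_list (map H c)) css)" for css
  have fibre_concat: "{css \<in> T. concat css = bs} = splits bs" if "bs \<in> splits \<alpha>" for bs
    using that by (auto simp: T_def splits_def)
  have fibre_map: "{css \<in> T. map concat css = ds} = refinements ds" if "ds \<in> splits \<alpha>" for ds
    using that by (force simp: T_def splits_def refinements_def concat_map_concat)
  have T_concat: "concat ` T \<subseteq> splits \<alpha>" by (auto simp: T_def splits_def)
  have T_map: "map concat ` T \<subseteq> splits \<alpha>"
  proof (rule image_subsetI)
    fix css assume "css \<in> T"
    then have css: "concat (concat css) = \<alpha>" "[] \<notin> set css" "[] \<notin> set (concat css)"
      by (auto simp: T_def)
    have "concat c \<noteq> []" if "c \<in> set css" for c
      using css(2,3) that by (cases c) auto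
    then have "[] \<notin> set (map concat css)" by (metis image_iff set_map)
    with css(1) show "map concat css \<in> splits \<alpha>"
      by (simp add: splits_def concat_map_concat)
  qed
  have "T \<subseteq> (\<Union>bs\<in>splits \<alpha>. splits bs)" by (auto simp: T_def splits_def)
  then have fin: "finite T" by (rule finite_subset) (simp add: finite_splits)
  have "plethysm (plethysm F G) H \<alpha> = (\<Sum>bs\<in>splits \<alpha>. \<Sum>css\<in>splits bs. h css)"
    unfolding plethysm_splits[OF collection_plethysm]
  proof (rule sum.cong[OF refl])
    fix bs assume bs: "bs \<in> splits \<alpha>"
    have "F (map nsum (map (map nsum) css)) * prod_list (map G (map (map nsum) css)) *
        prod_list (map H bs) = h css" if css: "css \<in> splits bs" for css
    proof -
      have "nsum (map nsum c) = nsum (concat c)" if "c \<in> set css" for c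
        using css bs that by (intro nsum_map_nsum) (auto simp: splits_def)
      then have "F (map nsum (map (map nsum) css)) = F (map nsum (map concat css))"
        by (simp add: o_def cong: map_cong)
      moreover have "prod_list (map H bs) = prod_list (map (\<lambda>c. prod_list (map H c)) css)"
        using css by (auto simp: splits_def simp flip: prod_list_map_concat)
      moreover have "prod_list (map G (map (map nsum) css)) =
          prod_list (map (\<lambda>c. G (map nsum c)) css)" by (simp add: o_def)
      ultimately show ?thesis by (simp only: h_def prod_list_map_mult mult.assoc)
    qed
    then show "plethysm F G (map nsum bs) * prod_list (map H bs) = (\<Sum>css\<in>splits bs. h css)"
      unfolding plethysm_splits[OF F] sum_splits_map sum_distrib_right
      by (intro sum.cong refl) auto
  qed
  also have "\<dots> = sum h T"
    using sum.group[OF fin finite_splits T_concat, of h] by (simp add: fibre_concat)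
  also have "\<dots> = (\<Sum>ds\<in>splits \<alpha>. \<Sum>css\<in>refinements ds. h css)"
    using sum.group[OF fin finite_splits T_map, of h] by (simp add: fibre_map)
  also have "\<dots> = plethysm F (plethysm G H) \<alpha>"
    unfolding plethysm_splits[OF F]
  proof (rule sum.cong[OF refl])
    fix ds
    show "(\<Sum>css\<in>refinements ds. h css) = F (map nsum ds) * prod_list (map (plethysm G H) ds)"
      unfolding plethysm_splits[OF G] prod_list_sum_splits sum_distrib_left
      by (intro sum.cong refl) (auto simp: h_def refinements_def)
  qed
  finally show "plethysm (plethysm F G) H \<alpha> = plethysm F (plethysm G H) \<alpha>" .
qed

lemma collection_id: "collection id_collection"
  by (simp add: collection_def id_collection_def)

lemma plethysm_id_left:
  assumes "collection F"
  shows "plethysm id_collection F = F"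
proof (rule ext)
  fix \<alpha> :: "'a list"
  show "plethysm id_collection F \<alpha> = F \<alpha>"
  proof (cases "\<alpha> = []")
    case True
    then show ?thesis using assms by (simp add: plethysm_def collection_def)
  next
    case False
    have "(\<Sum>bs\<in>splits \<alpha>. id_collection (map nsum bs) * prod_list (map F bs)) =
        (\<Sum>bs\<in>splits \<alpha>. if bs = [\<alpha>] then F \<alpha> else 0)"
      by (rule sum.cong) (auto simp: id_collection_def splits_def length_Suc_conv)
    also have "\<dots> = F \<alpha>"
      using False by (simp add: finite_splits) (simp add: splits_def)
    finally show ?thesis by (simp add: plethysm_splits collection_id)
  qed
qed

text \<open>
  With respect to the length of tuples, plethysm with a fixed right factor is triangular: only the
  cutting into singletons involves the value of the left factor at a tuple of full length.
\<close>

lemma splits_length_less: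
  assumes "bs \<in> splits \<alpha>" "bs \<noteq> map (\<lambda>x. [x]) \<alpha>"
  shows "length bs < length \<alpha>"
proof -
  have "length bs < length (concat bs)" if "[] \<notin> set bs" "bs \<noteq> map (\<lambda>x. [x]) (concat bs)"
    for bs :: "'a list list"
    using that
  proof (induction bs)
    case (Cons b bs)
    have le: "length bs \<le> length (concat bs)" if "[] \<notin> set bs" for bs :: "'a list list"
      using that
    proof (induction bs)
      case (Cons c cs)
      then show ?case by (cases c) auto
    qed simp
    obtain x b' where b: "b = x # b'" using Cons.prems by (cases b) auto
    show ?case
    proof (cases "b' = []")
      case True
      then show ?thesis using Cons b by auto
    next
      case False
      then have "0 < length b'" by simp
      moreover have "length bs \<le> length (concat bs)" using le Cons.prems by simp
      ultimately have "length (b # bs) < length b + length (concat bs)"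
        unfolding b list.size by linarith
      then show ?thesis by simp
    qed
  qed simp
  then show ?thesis using assms by (auto simp: splits_def)
qed

lemma plethysm_leading_term:
  assumes "collection F"
  shows "plethysm F G \<alpha> = F \<alpha> * prod_list (map (\<lambda>x. G [x]) \<alpha>) +
    (\<Sum>bs\<in>splits \<alpha> - {map (\<lambda>x. [x]) \<alpha>}. F (map nsum bs) * prod_list (map G bs))"
proof -
  have "map (\<lambda>x. [x]) \<alpha> \<in> splits \<alpha>" by (auto simp: splits_def)
  from sum.remove[OF finite_splits this, of "\<lambda>bs. F (map nsum bs) * prod_list (map G bs)"]
  show ?thesis by (simp add: plethysm_splits assms o_def)
qed

lemma plethysm_id_right:
  assumes "collection F"
  shows "plethysm F id_collection = F"
proof (rule ext)
  fix \<alpha> :: "'a list"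
  have "prod_list (map id_collection bs) = 0" if "bs \<in> splits \<alpha> - {map (\<lambda>x. [x]) \<alpha>}" for bs
  proof -
    have "\<not> (\<forall>b\<in>set bs. length b = 1)"
    proof
      assume *: "\<forall>b\<in>set bs. length b = 1"
      then have "bs = map (\<lambda>x. [x]) (concat bs)"
        by (induction bs) (auto simp: length_Suc_conv)
      with that show False by (auto simp: splits_def)
    qed
    then show ?thesis by (auto simp: prod_list_zero_iff id_collection_def image_iff)
  qed
  moreover have "prod_list (map (\<lambda>x. id_collection [x]) \<alpha>) = 1"
    by (induction \<alpha>) (auto simp: id_collection_def)
  ultimately show "plethysm F id_collection \<alpha> = F \<alpha>"
    by (simp add: plethysm_leading_term assms)
qed

text \<open>
  With the right factor equal to \<open>1\<close> on singletons the triangular system has diagonal \<open>1\<close>, so the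
  left factor is recovered by induction on the length.
\<close>

lemma plethysm_right_cancel:
  assumes F: "collection F" and F': "collection F'" and G: "\<And>x. G [x] = 1"
    and eq: "plethysm F G = plethysm F' G"
  shows "F = F'"
proof (rule ext)
  fix \<alpha>
  show "F \<alpha> = F' \<alpha>"
  proof (induction \<alpha> rule: length_induct)
    case (1 \<alpha>)
    have one: "prod_list (map (\<lambda>x. G [x]) \<alpha>) = 1" by (induction \<alpha>) (auto simp: G)
    have "(\<Sum>bs\<in>splits \<alpha> - {map (\<lambda>x. [x]) \<alpha>}. F (map nsum bs) * prod_list (map G bs)) =
        (\<Sum>bs\<in>splits \<alpha> - {map (\<lambda>x. [x]) \<alpha>}. F' (map nsum bs) * prod_list (map G bs))"
    proof (rule sum.cong[OF refl])
      fix bs assume "bs \<in> splits \<alpha> - {map (\<lambda>x. [x]) \<alpha>}"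
      then have "length (map nsum bs) < length \<alpha>" using splits_length_less by auto
      then show "F (map nsum bs) * prod_list (map G bs) = F' (map nsum bs) * prod_list (map G bs)"
        using 1 by metis
    qed
    with fun_cong[OF eq, of \<alpha>] show ?case
      by (simp add: plethysm_leading_term F F' one)
  qed
qed

text \<open>
  If \<open>G \<circ> F = 1\<close> then \<open>(F \<circ> G) \<circ> F = F \<circ> (G \<circ> F) = F = 1 \<circ> F\<close>, and cancelling \<open>F\<close> on the right
  gives \<open>F \<circ> G = 1\<close>. The same cancellation gives uniqueness.
\<close>

lemma plethysm_inverse_eqI:
  assumes F: "collection F" "\<And>x. F [x] = 1" and G: "collection G"
    and inv: "plethysm G F = id_collection"
  shows "plethysm_inverse F = G"
proof -
  have "plethysm (plethysm F G) F = plethysm id_collection F"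
    by (simp add: plethysm_assoc F G inv plethysm_id_right plethysm_id_left)
  then have "plethysm F G = id_collection"
    by (rule plethysm_right_cancel[where G = F, OF collection_plethysm collection_id F(2)])
  moreover have "H = G" if "collection H" "plethysm H F = id_collection" for H
    by (rule plethysm_right_cancel[of _ _ F]) (use that G inv F(2) in auto)
  ultimately show ?thesis
    unfolding plethysm_inverse_def using G inv by (intro the_equality conjI) blast+
qed

section \<open>Expanding a product of differences\<close>

text \<open>
  The value \<open>0\<close> on the empty list makes this a collection; every longer list reaches the
  singleton case.
\<close>

fun adjacent_prod :: "('a \<Rightarrow> 'a \<Rightarrow> rat) \<Rightarrow> 'a list \<Rightarrow> rat" where
  "adjacent_prod A [] = 0"
| "adjacent_prod A [x] = 1"
| "adjacent_prod A (x # y # ys) = A x y * adjacent_prod A (y # ys)"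

text \<open>
  In \<open>cut_prod\<close> and \<open>diff_prod\<close> below, \<open>p\<close> is the sum of the entries already passed, and in
  \<open>diff_prod\<close> the entry \<open>y\<close> is the last of these. Keeping \<open>p\<close> and \<open>y\<close> independent is what allows
  the inductions along the remaining list.
\<close>

fun cut_prod :: "('a::ab_semigroup_add \<Rightarrow> 'a \<Rightarrow> rat) \<Rightarrow> 'a \<Rightarrow> 'a list \<Rightarrow> rat" where
  "cut_prod B p [] = 1"
| "cut_prod B p (z # zs) = - B p (nsum (z # zs)) * cut_prod B (p + z) zs"

fun diff_prod ::
    "('a \<Rightarrow> 'a \<Rightarrow> rat) \<Rightarrow> ('a::ab_semigroup_add \<Rightarrow> 'a \<Rightarrow> rat) \<Rightarrow> 'a \<Rightarrow> 'a \<Rightarrow> 'a list \<Rightarrow> rat" where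
  "diff_prod A B p y [] = 1"
| "diff_prod A B p y (z # zs) = (A y z - B p (nsum (z # zs))) * diff_prod A B (p + z) z zs"

definition cut_collection :: "('a::ab_semigroup_add \<Rightarrow> 'a \<Rightarrow> rat) \<Rightarrow> 'a list \<Rightarrow> rat" where
  "cut_collection B \<alpha> = (case \<alpha> of [] \<Rightarrow> 0 | x # xs \<Rightarrow> cut_prod B x xs)"

text \<open>
  The induction removes the first entry \<open>y\<close>. A cut after \<open>y\<close> contributes the factor \<open>- B\<close>, and
  joining \<open>y\<close> to the next block contributes the factor \<open>A\<close>. In both cases the same sum remains
  over the cuttings of the rest, with \<open>y\<close> counted in the prefix. The function \<open>f\<close> stands for adding this
  prefix: the identity at the start, a translation once entries have been passed.
\<close>

lemma sum_splits_cut_adjacent: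
  assumes "\<And>a b. f (a + b) = f a + b"
  shows "(\<Sum>bs\<in>splits (y # zs). cut_prod B (f (nsum (hd bs))) (map nsum (tl bs)) *
      prod_list (map (adjacent_prod A) bs)) = diff_prod A B (f y) y zs"
  using assms
proof (induction zs arbitrary: f y)
  case Nil
  then show ?case by (simp add: splits_single)
next
  case (Cons z zs)
  let ?S = "splits (z # zs)"
  let ?t = "\<lambda>bs. cut_prod B (f y + nsum (hd bs)) (map nsum (tl bs)) * prod_list (map (adjacent_prod A) bs)"
  have "(\<Sum>bs\<in>splits (y # z # zs). cut_prod B (f (nsum (hd bs))) (map nsum (tl bs)) *
      prod_list (map (adjacent_prod A) bs)) = (\<Sum>bs\<in>?S. (A y z - B (f y) (nsum (z # zs))) * ?t bs)"
    unfolding sum_splits_Cons_Cons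
  proof (rule sum.cong[OF refl])
    fix bs assume bs: "bs \<in> ?S"
    then obtain b cs where bcs: "bs = b # cs"
      using splits_nonempty[OF bs] by (cases bs) auto
    with bs obtain b' where b': "b = z # b'" by (cases b) (auto simp: splits_def)
    \<comment> \<open>A cut after \<open>y\<close> compares the prefix with everything that follows, however that is cut.\<close>
    have total: "nsum (nsum b # map nsum cs) = nsum (z # zs)"
      using nsum_map_nsum[of bs] bs bcs by (auto simp: splits_def)
    have "f (nsum (y # b)) = f y + nsum b" using Cons.prems b' by simp
    with total bcs b'
    show "cut_prod B (f (nsum (hd ([y] # bs)))) (map nsum (tl ([y] # bs))) *
        prod_list (map (adjacent_prod A) ([y] # bs)) +
      cut_prod B (f (nsum (hd ((y # hd bs) # tl bs)))) (map nsum (tl ((y # hd bs) # tl bs))) *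
        prod_list (map (adjacent_prod A) ((y # hd bs) # tl bs)) =
      (A y z - B (f y) (nsum (z # zs))) * ?t bs"
      by (simp add: algebra_simps)
  qed
  also have "\<dots> = (A y z - B (f y) (nsum (z # zs))) * diff_prod A B (f y + z) z zs"
    unfolding sum_distrib_left[symmetric]
    by (subst Cons.IH[of "\<lambda>a. f y + a"]) (simp_all add: add.assoc)
  finally show ?case by simp
qed

lemma plethysm_cut_adjacent:
  "plethysm (cut_collection B) (adjacent_prod A) (y # zs) = diff_prod A B y y zs"
proof -
  have "collection (cut_collection B)" by (simp add: collection_def cut_collection_def)
  then have "plethysm (cut_collection B) (adjacent_prod A) (y # zs) =
      (\<Sum>bs\<in>splits (y # zs). cut_prod B (nsum (hd bs)) (map nsum (tl bs)) *
        prod_list (map (adjacent_prod A) bs))"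
    unfolding plethysm_splits[OF \<open>collection _\<close>]
    by (intro sum.cong refl)
      (auto simp: cut_collection_def split: list.split dest: splits_nonempty)
  then show ?thesis using sum_splits_cut_adjacent[of "\<lambda>a. a" B A y zs] by simp
qed

section \<open>Stabilities\<close>

text \<open>
  The weight is used for adjacent entries as well as for the sums of a prefix and a suffix.
\<close>

definition descent :: "('a \<Rightarrow> 'a \<Rightarrow> bool) \<Rightarrow> 'a \<Rightarrow> 'a \<Rightarrow> rat" where
  "descent le x y = of_bool (strict le y x)"

lemma HN_collection_eq_adjacent_prod: "HN_collection le = adjacent_prod (descent le)"
proof (rule ext)
  fix \<alpha> :: "'a list"
  show "HN_collection le \<alpha> = adjacent_prod (descent le) \<alpha>"
    by (induction \<alpha> rule: induct_list012) (auto simp: HN_collection_def descent_def)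
qed

context
  fixes le :: "'a::ab_semigroup_add \<Rightarrow> 'a \<Rightarrow> bool"
  assumes stab: "stability le"
begin

lemma stab_trans: "le a b \<Longrightarrow> le b c \<Longrightarrow> le a c"
  using stab by (auto simp: stability_def dest: transpD)

lemma stab_total: "le a b \<or> le b a"
  using stab by (auto simp: stability_def)

lemma strict_iff: "strict le a b \<longleftrightarrow> \<not> le b a"
  using stab_total by (auto simp: strict_def)

lemma seesaw: "(le a (a + b) \<and> le (a + b) b) \<or> (le b (a + b) \<and> le (a + b) a)"
  using stab by (auto simp: stability_def)

text \<open>
  A nonzero first factor forces \<open>y \<le> z\<close>, since the prefix \<open>p\<close> exceeds the rest. Then \<open>z \<ge> y\<close>
  exceeds the sum of \<open>z\<close> and the entries after it, so by the seesaw property those entries have a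
  smaller sum than \<open>z\<close>. Both hypotheses thus pass to \<open>p + z\<close> and \<open>z\<close>. At the last entry they
  contradict \<open>y \<le> z\<close>.
\<close>

lemma diff_prod_descending_zero:
  assumes "zs \<noteq> []" "strict le (nsum zs) p" "strict le (nsum zs) y"
  shows "diff_prod (descent le) (descent le) p y zs = 0"
  using assms
proof (induction zs arbitrary: p y)
  case (Cons z zs)
  show ?case
  proof (cases "strict le z y")
    case True
    then show ?thesis using Cons.prems by (simp add: descent_def)
  next
    case False
    then have yz: "le y z" by (simp add: strict_iff)
    have "zs \<noteq> []" using Cons.prems yz by (auto simp: strict_iff)
    let ?R = "nsum zs"
    have lt: "\<not> le p (z + ?R)" "\<not> le y (z + ?R)"
      using Cons.prems \<open>zs \<noteq> []\<close> by (auto simp: nsum_Cons strict_iff)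
    then have "\<not> le z (z + ?R)" using yz stab_trans by blast
    then have "le ?R (z + ?R)" using seesaw by blast
    then have zR: "\<not> le z ?R" and pR: "\<not> le p ?R"
      using lt yz stab_trans by blast+
    \<comment> \<open>A sum lies between its two summands, both of which exceed \<open>?R\<close>.\<close>
    have "\<not> le (p + z) ?R"
      using seesaw[of p z] zR pR stab_trans by blast
    then show ?thesis
      using Cons.IH[OF \<open>zs \<noteq> []\<close>, of "p + z" z] zR by (simp add: strict_iff)
  qed
qed simp

text \<open>
  The mirror image: a nonzero first factor now forces \<open>y > z\<close>, and \<open>p\<close> and \<open>y\<close> staying below the
  rest passes to \<open>p + z\<close> and \<open>z\<close>.
\<close>

lemma diff_prod_ascending_zero:
  assumes "zs \<noteq> []" "le p (nsum zs)" "le y (nsum zs)"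
  shows "diff_prod (descent le) (descent le) p y zs = 0"
  using assms
proof (induction zs arbitrary: p y)
  case (Cons z zs)
  show ?case
  proof (cases "strict le z y")
    case False
    then show ?thesis using Cons.prems by (simp add: descent_def strict_iff)
  next
    case True
    then have yz: "\<not> le y z" by (simp add: strict_iff)
    then have "zs \<noteq> []" using Cons.prems by auto
    let ?R = "nsum zs"
    have lt: "le p (z + ?R)" "le y (z + ?R)"
      using Cons.prems \<open>zs \<noteq> []\<close> by (auto simp: nsum_Cons)
    then have "\<not> le (z + ?R) z" using yz stab_trans by blast
    then have "le (z + ?R) ?R" using seesaw by blast
    then have pR: "le p ?R" and yR: "le y ?R"
      using lt stab_trans by blast+
    then have zR: "le z ?R"
      using yz stab_total stab_trans by blast
    have "le (p + z) ?R"
      using seesaw[of p z] zR pR stab_trans by blast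
    then show ?thesis
      using Cons.IH[OF \<open>zs \<noteq> []\<close>, of "p + z" z] zR by simp
  qed
qed simp

lemma plethysm_inverse_HN:
  "plethysm_inverse (HN_collection le) = cut_collection (descent le)"
proof (rule plethysm_inverse_eqI)
  show "plethysm (cut_collection (descent le)) (HN_collection le) = id_collection"
  proof (rule ext)
    fix \<alpha> :: "'a list"
    show "plethysm (cut_collection (descent le)) (HN_collection le) \<alpha> = id_collection \<alpha>"
    proof (cases \<alpha>)
      case Nil
      then show ?thesis by (simp add: plethysm_def id_collection_def)
    next
      case (Cons y zs)
      have "diff_prod (descent le) (descent le) y y zs = 0" if "zs \<noteq> []"
        using that diff_prod_descending_zero diff_prod_ascending_zero
        by (cases "le y (nsum zs)") (auto simp: strict_iff)
      then show ?thesis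
        by (simp add: Cons HN_collection_eq_adjacent_prod plethysm_cut_adjacent id_collection_def)
    qed
  qed
qed (auto simp: collection_def HN_collection_def cut_collection_def)

end

lemma wc_sign_eq_diff:
  assumes "stability le" "stability le'"
  shows "wc_sign le le' \<alpha> k = descent le (\<alpha> ! (k - 1)) (\<alpha> ! k) -
    descent le' (nsum (take k \<alpha>)) (nsum (drop k \<alpha>))"
  by (auto simp: wc_sign_def descent_def strict_iff[OF assms(1)] strict_iff[OF assms(2)])

lemma diff_prod_eq_prod:
  assumes "us \<noteq> []"
  shows "diff_prod A B (nsum us) (last us) zs = (\<Prod>k = length us..<length (us @ zs).
    A ((us @ zs) ! (k - 1)) ((us @ zs) ! k) - B (nsum (take k (us @ zs))) (nsum (drop k (us @ zs))))"
  using assms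
proof (induction zs arbitrary: us)
  case (Cons z zs)
  let ?f = "\<lambda>k. A ((us @ z # zs) ! (k - 1)) ((us @ z # zs) ! k) -
    B (nsum (take k (us @ z # zs))) (nsum (drop k (us @ z # zs)))"
  have "(\<Prod>k = length us..<length (us @ z # zs). ?f k) =
      ?f (length us) * (\<Prod>k = Suc (length us)..<length (us @ z # zs). ?f k)"
    by (rule prod.atLeast_Suc_lessThan) simp
  also have "?f (length us) = A (last us) z - B (nsum us) (nsum (z # zs))"
    using Cons.prems by (simp add: nth_append last_conv_nth)
  also have "(\<Prod>k = Suc (length us)..<length (us @ z # zs). ?f k) =
      diff_prod A B (nsum us + z) z zs"
    using Cons.IH[of "us @ [z]"] Cons.prems by (simp add: nsum_append)
  finally show ?case by simp
qed simp

theorem theorem2p14: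
  fixes le le' :: "'a::ab_semigroup_add \<Rightarrow> 'a \<Rightarrow> bool" and \<alpha> :: "'a list"
  assumes "\<And>a::'a. finite {\<beta>. \<beta> \<noteq> [] \<and> nsum \<beta> = a}"
    and "stability le" and "stability le'"
    and "\<alpha> \<noteq> []"
  shows "transition_collection le le' \<alpha> = (\<Prod>k = 1..<length \<alpha>. wc_sign le le' \<alpha> k)"
proof -
  obtain y zs where \<alpha>: "\<alpha> = y # zs" using assms(4) by (cases \<alpha>) auto
  have "transition_collection le le' \<alpha> = diff_prod (descent le) (descent le') y y zs"
    unfolding transition_collection_def plethysm_inverse_HN[OF assms(3)]
    by (simp add: HN_collection_eq_adjacent_prod plethysm_cut_adjacent \<alpha>)
  also have "\<dots> = (\<Prod>k = 1..<length \<alpha>. wc_sign le le' \<alpha> k)"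
    using diff_prod_eq_prod[of "[y]" "descent le" "descent le'" zs]
    by (simp add: \<alpha> wc_sign_eq_diff assms)
  finally show ?thesis .
qed

end
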